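(* Let $\lambda$ be a nonzero real number. For an integer $r\ge0$ and (real or complex) $x$ define $K_r(x\mid\lambda)=\sum_{n=0}^{\infty}\frac{x^n}{n!}(n)_{r,\lambda}$. Then for every $r\ge0$, $$ K_{r}(x\mid\lambda)=e^{x}\sum_{j=0}^{r}x^{j}{r \brace j}_{\lambda}, \qquad K_{r+1}(x\mid\lambda)=x\sum_{j=0}^{r}\binom{r}{j}K_{j}(x\mid\lambda)(1-\lambda)_{r-j,\lambda}. $$
   Context: For a real parameter $\mu$ the degenerate falling factorials are $(x)_{0,\mu}=1$ and $(x)_{n,\mu}=x(x-\mu)\cdots(x-(n-1)\mu)$ for $n\ge1$; $(x)_n=(x)_{n,1}$ is the usual falling factorial. The degenerate Stirling numbers of the second kind ${n \brace k}_{\mu}$ are defined by $(x)_{n,\mu}=\sum_{k=0}^{n}{n \brace k}_{\mu}(x)_k$. *)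

theory Defs
  imports Complex_Main
begin

definition dfall :: "real \<Rightarrow> real \<Rightarrow> nat \<Rightarrow> real" where
  "dfall \<mu> x n = (\<Prod>i<n. x - real i * \<mu>)"

text \<open>
  The coefficient sequence of \<open>(x)\<^sub>n\<^sub>,\<^sub>\<mu>\<close> in the basis of ordinary falling factorials
  \<open>(x)\<^sub>k = dfall 1 x k\<close>, extended by zero for \<open>k > n\<close> so that it is a unique function on \<open>nat\<close>;
  existence and uniqueness are the lemma \<open>degen_stirling2_ex1\<close> below.
\<close>

definition is_degen_stirling2_row :: "real \<Rightarrow> nat \<Rightarrow> (nat \<Rightarrow> real) \<Rightarrow> bool" where
  "is_degen_stirling2_row \<mu> n S \<longleftrightarrow>
     (\<forall>k>n. S k = 0) \<and> (\<forall>x. dfall \<mu> x n = (\<Sum>k\<le>n. S k * dfall 1 x k))"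

definition degen_stirling2 :: "real \<Rightarrow> nat \<Rightarrow> nat \<Rightarrow> real" where
  "degen_stirling2 \<mu> n k = (THE S. is_degen_stirling2_row \<mu> n S) k"

definition degen_K :: "nat \<Rightarrow> 'a::{real_normed_field,banach} \<Rightarrow> real \<Rightarrow> 'a" where
  "degen_K r x l = (\<Sum>n. x ^ n / fact n * of_real (dfall l (real n) r))"

lemma degen_stirling2_row_exists: "\<exists>S. is_degen_stirling2_row \<mu> n S"
proof (induction n)
  case 0
  have "is_degen_stirling2_row \<mu> 0 (\<lambda>k. if k = 0 then 1 else 0)"
    by (simp add: is_degen_stirling2_row_def dfall_def)
  then show ?case by blast
next
  case (Suc n)
  then obtain S where S0: "\<And>k. k > n \<Longrightarrow> S k = 0"
    and S: "\<And>x. dfall \<mu> x n = (\<Sum>k\<le>n. S k * dfall 1 x k)"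
    by (auto simp: is_degen_stirling2_row_def)
  define T where "T k = (if k = 0 then 0 else S (k - 1)) + (real k - real n * \<mu>) * S k" for k
  have "dfall \<mu> x (Suc n) = (\<Sum>k\<le>Suc n. T k * dfall 1 x k)" for x
  proof -
    have st: "(x - real n * \<mu>) * dfall 1 x k
        = dfall 1 x (Suc k) + (real k - real n * \<mu>) * dfall 1 x k" for k
      by (simp add: dfall_def algebra_simps)
    have "dfall \<mu> x (Suc n) = (x - real n * \<mu>) * dfall \<mu> x n"
      by (simp add: dfall_def)
    also have "\<dots> = (\<Sum>k\<le>n. S k * ((x - real n * \<mu>) * dfall 1 x k))"
      by (simp add: S sum_distrib_left mult_ac)
    also have "\<dots> = (\<Sum>k\<le>n. S k * dfall 1 x (Suc k))
        + (\<Sum>k\<le>n. (real k - real n * \<mu>) * S k * dfall 1 x k)"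
      unfolding st distrib_left sum.distrib by (simp add: mult_ac)
    also have "(\<Sum>k\<le>n. S k * dfall 1 x (Suc k))
        = (\<Sum>k\<le>Suc n. (if k = 0 then 0 else S (k - 1)) * dfall 1 x k)"
      by (subst sum.atMost_Suc_shift) simp
    also have "(\<Sum>k\<le>n. (real k - real n * \<mu>) * S k * dfall 1 x k)
        = (\<Sum>k\<le>Suc n. (real k - real n * \<mu>) * S k * dfall 1 x k)"
      by (simp add: S0)
    finally show ?thesis
      unfolding T_def distrib_right sum.distrib .
  qed
  moreover have "\<forall>k>Suc n. T k = 0"
    by (auto simp: T_def S0)
  ultimately show ?case
    unfolding is_degen_stirling2_row_def by blast
qed

lemma degen_stirling2_row_unique:
  assumes "is_degen_stirling2_row \<mu> n S" "is_degen_stirling2_row \<mu> n T"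
  shows "S = T"
proof
  fix m show "S m = T m"
  proof (induction m rule: less_induct)
    case (less m)
    show ?case
    proof (cases "m \<le> n")
      case True
      have z: "dfall 1 (real m) k = 0" if "k > m" for k
        using that by (auto simp: dfall_def)
      have nz: "dfall 1 (real m) m \<noteq> 0"
        by (auto simp: dfall_def)
      have e: "(\<Sum>k\<le>n. U k * dfall 1 (real m) k)
          = (\<Sum>k<m. U k * dfall 1 (real m) k) + U m * dfall 1 (real m) m" for U :: "nat \<Rightarrow> real"
      proof -
        have "(\<Sum>k\<le>n. U k * dfall 1 (real m) k) = (\<Sum>k\<le>m. U k * dfall 1 (real m) k)"
          using True z by (intro sum.mono_neutral_right) auto
        then show ?thesis
          by (simp flip: lessThan_Suc_atMost)
      qed
      have "(\<Sum>k\<le>n. S k * dfall 1 (real m) k) = (\<Sum>k\<le>n. T k * dfall 1 (real m) k)"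
        using assms by (metis is_degen_stirling2_row_def)
      moreover have "(\<Sum>k<m. S k * dfall 1 (real m) k) = (\<Sum>k<m. T k * dfall 1 (real m) k)"
        using less by (intro sum.cong) auto
      ultimately show ?thesis
        using nz by (simp add: e)
    next
      case False
      then show ?thesis
        using assms by (simp add: is_degen_stirling2_row_def)
    qed
  qed
qed

lemma degen_stirling2_ex1: "\<exists>!S. is_degen_stirling2_row \<mu> n S"
  using degen_stirling2_row_exists degen_stirling2_row_unique by blast

lemma dfall_eq_sum_degen_stirling2:
  "dfall \<mu> x n = (\<Sum>k\<le>n. degen_stirling2 \<mu> n k * dfall 1 x k)"
proof -
  have "is_degen_stirling2_row \<mu> n (degen_stirling2 \<mu> n)"
    using theI'[OF degen_stirling2_ex1[of \<mu> n]] by (simp add: degen_stirling2_def[abs_def])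
  then show ?thesis
    by (simp add: is_degen_stirling2_row_def)
qed

end

theory Submission
  imports Defs
begin

text \<open>
  Removing the factor \<open>n\<close> from \<open>x\<^sup>n / n! * n * g(n)\<close> shifts the index and pulls out one \<open>x\<close>. As
  \<open>(n)\<^sub>k\<^sub>+\<^sub>1 = n (n - 1)\<^sub>k\<close>, iterating this shows that the series with weights \<open>(n)\<^sub>k\<close> sums to
  \<open>x\<^sup>k e\<^sup>x\<close>, and the first formula is the linear expansion of \<open>(n)\<^sub>r\<^sub>,\<^sub>\<lambda>\<close> in the \<open>(n)\<^sub>k\<close>.
  The same shift applied to \<open>(n)\<^sub>r\<^sub>+\<^sub>1\<^sub>,\<^sub>\<lambda> = n (n - \<lambda>)\<^sub>r\<^sub>,\<^sub>\<lambda>\<close> leaves the weights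
  \<open>(n + (1 - \<lambda>))\<^sub>r\<^sub>,\<^sub>\<lambda>\<close>, which the Vandermonde identity expands into the recurrence.
\<close>

lemma dfall_0 [simp]: "dfall \<mu> x 0 = 1"
  by (simp add: dfall_def)

lemma dfall_Suc: "dfall \<mu> x (Suc n) = (x - real n * \<mu>) * dfall \<mu> x n"
  by (simp add: dfall_def)

lemma dfall_Suc_shift: "dfall \<mu> x (Suc n) = x * dfall \<mu> (x - \<mu>) n"
  unfolding dfall_def by (subst prod.lessThan_Suc_shift) (simp add: algebra_simps)

text \<open>Induction on \<open>n\<close>: the new factor splits as
  \<open>(x - j * \<mu>) + (y - (n - j) * \<mu>)\<close>, each half extends one of the two products,
  and Pascal's rule merges the sums.\<close>

lemma dfall_Vandermonde:
  "dfall \<mu> (x + y) n = (\<Sum>j\<le>n. real (n choose j) * dfall \<mu> x j * dfall \<mu> y (n - j))"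
proof (induction n)
  case 0
  then show ?case by simp
next
  case (Suc n)
  define t where "t i j = dfall \<mu> x i * dfall \<mu> y j" for i j
  have step: "(x + y - real n * \<mu>) * t j (n - j) = t (Suc j) (n - j) + t j (Suc n - j)"
    if "j \<le> n" for j
    using that by (simp add: t_def dfall_Suc Suc_diff_le of_nat_diff algebra_simps)
  have "dfall \<mu> (x + y) (Suc n)
      = (\<Sum>j\<le>n. real (n choose j) * ((x + y - real n * \<mu>) * t j (n - j)))"
    by (simp add: dfall_Suc Suc sum_distrib_left t_def mult_ac)
  also have "\<dots> = (\<Sum>j\<le>n. real (n choose j) * t (Suc j) (n - j))
      + (\<Sum>j\<le>n. real (n choose j) * t j (Suc n - j))"
    by (simp add: step distrib_left flip: sum.distrib)
  \<comment> \<open>The added term vanishes since \<open>n choose Suc n = 0\<close>.\<close>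
  also have "(\<Sum>j\<le>n. real (n choose j) * t j (Suc n - j))
      = (\<Sum>j\<le>Suc n. real (n choose j) * t j (Suc n - j))"
    by simp
  also have "\<dots> = t 0 (Suc n) + (\<Sum>j\<le>n. real (n choose Suc j) * t (Suc j) (n - j))"
    by (subst sum.atMost_Suc_shift) simp
  also have "(\<Sum>j\<le>n. real (n choose j) * t (Suc j) (n - j))
        + (t 0 (Suc n) + (\<Sum>j\<le>n. real (n choose Suc j) * t (Suc j) (n - j)))
      = t 0 (Suc n) + (\<Sum>j\<le>n. real (Suc n choose Suc j) * t (Suc j) (n - j))"
    by (simp add: sum.distrib distrib_right)
  also have "\<dots> = (\<Sum>j\<le>Suc n. real (Suc n choose j) * t j (Suc n - j))"
    by (subst sum.atMost_Suc_shift) simp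
  finally show ?case
    by (simp only: t_def mult.assoc)
qed

lemma sums_exp_series_shift:
  fixes x S :: "'a::{real_normed_field,banach}"
  assumes "(\<lambda>n. x ^ n / fact n * of_real (g (Suc n))) sums S"
  shows "(\<lambda>n. x ^ n / fact n * of_real (real n * g n)) sums (x * S)"
proof -
  have "x ^ Suc n / fact (Suc n) * of_real (real (Suc n) * g (Suc n))
      = x * (x ^ n / fact n * of_real (g (Suc n)))" for n
    by (simp add: divide_simps del: of_nat_Suc)
  then have "(\<lambda>n. x ^ Suc n / fact (Suc n) * of_real (real (Suc n) * g (Suc n))) sums (x * S)"
    using sums_mult[OF assms, of x] by simp
  \<comment> \<open>The factor \<open>real n\<close> kills the term at index 0, so prepending it
    leaves the sum unchanged.\<close>
  then show ?thesis
    by (subst (asm) sums_Suc_iff) simp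
qed

lemma dfall_1_exp_series_sums:
  fixes x :: "'a::{real_normed_field,banach}"
  shows "(\<lambda>n. x ^ n / fact n * of_real (dfall 1 (real n) k)) sums (x ^ k * exp x)"
proof (induction k)
  case 0
  show ?case
    using exp_converges[of x] by (simp add: scaleR_conv_of_real field_simps)
next
  case (Suc k)
  \<comment> \<open>The weight \<open>g\<close> is shifted back by one so that
    \<open>g (Suc n)\<close> is the weight of the induction hypothesis.\<close>
  then show ?case
    using sums_exp_series_shift[of x "\<lambda>n. dfall 1 (real n - 1) k"]
    by (simp add: dfall_Suc_shift mult.assoc)
qed

lemma dfall_exp_series_sums:
  fixes x :: "'a::{real_normed_field,banach}"
  shows "(\<lambda>n. x ^ n / fact n * of_real (dfall l (real n) r)) sums
    (exp x * (\<Sum>j\<le>r. x ^ j * of_real (degen_stirling2 l r j)))"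
proof -
  have "(\<lambda>n. \<Sum>j\<le>r. of_real (degen_stirling2 l r j)
          * (x ^ n / fact n * of_real (dfall 1 (real n) j)))
      sums (\<Sum>j\<le>r. of_real (degen_stirling2 l r j) * (x ^ j * exp x))"
    by (intro sums_sum sums_mult dfall_1_exp_series_sums)
  then show ?thesis
    by (simp add: dfall_eq_sum_degen_stirling2[of l] sum_distrib_left mult_ac)
qed

text \<open>The closed form supplies the convergence that makes the \<open>suminf\<close> in
  \<open>degen_K\<close> a genuine limit.\<close>

lemma dfall_exp_series_sums_degen_K:
  fixes x :: "'a::{real_normed_field,banach}"
  shows "(\<lambda>n. x ^ n / fact n * of_real (dfall l (real n) r)) sums degen_K r x l"
  unfolding degen_K_def by (rule summable_sums[OF sums_summable[OF dfall_exp_series_sums]])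

lemma degen_K_Suc:
  fixes x :: "'a::{real_normed_field,banach}"
  shows "degen_K (Suc r) x l
    = x * (\<Sum>j\<le>r. of_nat (r choose j) * degen_K j x l * of_real (dfall l (1 - l) (r - j)))"
    (is "_ = x * ?S")
proof -
  have "(\<lambda>n. \<Sum>j\<le>r. of_nat (r choose j) * (x ^ n / fact n * of_real (dfall l (real n) j))
      * of_real (dfall l (1 - l) (r - j))) sums ?S"
    by (intro sums_sum sums_mult sums_mult2 dfall_exp_series_sums_degen_K)
  moreover have "(\<Sum>j\<le>r. of_nat (r choose j) * (x ^ n / fact n * of_real (dfall l (real n) j))
        * of_real (dfall l (1 - l) (r - j)))
      = x ^ n / fact n * of_real (dfall l (real (Suc n) - l) r)" for n
  proof -
    have "real (Suc n) - l = real n + (1 - l)"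
      by simp
    then show ?thesis
      by (simp only: dfall_Vandermonde) (simp add: sum_distrib_left mult_ac)
  qed
  ultimately have "(\<lambda>n. x ^ n / fact n * of_real (real n * dfall l (real n - l) r)) sums (x * ?S)"
    by (intro sums_exp_series_shift) simp
  \<comment> \<open>Folding \<open>n * dfall l (n - l) r\<close> back gives the series of
    \<open>degen_K (Suc r) x l\<close>; limits are unique.\<close>
  then show ?thesis
    unfolding dfall_Suc_shift[symmetric]
    by (rule sums_unique2[OF dfall_exp_series_sums_degen_K])
qed

theorem theorem2p13:
  fixes l :: real and r :: nat and x :: "'a::{real_normed_field,banach}"
  assumes "l \<noteq> 0"
  shows "summable (\<lambda>n. x ^ n / fact n * of_real (dfall l (real n) r))
    \<and> degen_K r x l = exp x * (\<Sum>j=0..r. x ^ j * of_real (degen_stirling2 l r j))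
    \<and> degen_K (r + 1) x l
         = x * (\<Sum>j=0..r. of_nat (r choose j) * degen_K j x l * of_real (dfall l (1 - l) (r - j)))"
  using sums_summable[OF dfall_exp_series_sums[of x l r]]
    sums_unique2[OF dfall_exp_series_sums_degen_K dfall_exp_series_sums, of r x l]
    degen_K_Suc[of r x l]
  by (simp add: atMost_atLeast0)

end
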